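(* Let $\delta>0$, let $(X,d,\mu)$ be an Ahlfors $\delta$-regular metric-measure space and let $\Delta$ be its logarithmic Dirichlet Laplacian on $L^2(X,\mu)$. For every $0<\alpha\le 1$ we have $$\Delta(\text{Höl}_{<\alpha}(X,d))\subset \text{Höl}_{<\alpha}(X,d),$$ and hence $\text{Höl}_{<\alpha}(X,d)\subset C^\infty(\Delta)$.
   Context: A metric-measure space is a triple $(X,d,\mu)$ where $(X,d)$ is a locally compact second-countable metric space and $\mu$ is a finite Borel measure on $X$. It is Ahlfors $\delta$-regular ($\delta>0$) if there is $C\ge 1$ such that $C^{-1}r^\delta\le\mu(\overline B(x,r))\le Cr^\delta$ for all $x\in X$ and $0\le r<\operatorname{diam}X$; then $\operatorname{diam} X<\infty$. $L^2(X,\mu)$ denotes the real Hilbert space of real-valued square-integrable functions. Define $$\operatorname{Dom}\mathcal E=\Big\{f\in L^2(X,\mu):\int_X\int_X\frac{|f(x)-f(y)|^2}{d(x,y)^\delta}\,d\mu(y)\,d\mu(x)<\infty\Big\},$$ $$\mathcal E(f,g)=\frac12\int_X\int_X\frac{(f(x)-f(y))(g(x)-g(y))}{d(x,y)^\delta}\,d\mu(y)\,d\mu(x),\qquad f,g\in\operatorname{Dom}\mathcal E,$$ the integrals being over the complement of the diagonal in $X\times X$. This is a densely defined closed form. The logarithmic Dirichlet Laplacian $\Delta$ is the positive self-adjoint operator associated with $\mathcal E$: if $R:L^2(X,\mu)\to\operatorname{Dom}\mathcal E$ is determined by $\langle Rf,g\rangle_{L^2}+\mathcal E(Rf,g)=\langle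 f,g\rangle_{L^2}$ for all $g\in\operatorname{Dom}\mathcal E$, then $\operatorname{Dom}\Delta=R(L^2(X,\mu))$ and $\Delta Rf=f-Rf$. Thus $R=(1+\Delta)^{-1}$, $\operatorname{Dom}\mathcal E=\operatorname{Dom}\Delta^{1/2}$ and $\mathcal E(f,g)=\langle\Delta^{1/2}f,\Delta^{1/2}g\rangle_{L^2}$. For $0<\alpha\le1$, $\text{Höl}_{<\alpha}(X,d)$ is the set of bounded uniformly continuous functions $f:X\to\mathbb R$ that are $\beta$-Hölder for every $0<\beta<\alpha$, i.e. for each such $\beta$ there is a constant $C_{f,\beta}$ with $|f(x)-f(y)|\le C_{f,\beta}\,d(x,y)^\beta$ for all $x,y\in X$. These functions belong to $\operatorname{Dom}\Delta$ (as elements of $L^2(X,\mu)$). The set of smooth vectors of $\Delta$ is $C^\infty(\Delta)=\bigcap_{n=1}^\infty\operatorname{Dom}(\Delta^n)$. *)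

theory Defs
  imports "HOL-Analysis.Analysis"
begin

locale metric_measure_space = finite_measure M
  for M :: "'a::{metric_space, second_countable_topology} measure" +
  assumes locally_compact_space: "locally compact (UNIV :: 'a set)"
    and borel_sets: "sets M = sets borel"

text \<open>
  The diameter of the whole space is taken in the extended reals, since \<^const>\<open>diameter\<close>
  is only meaningful for bounded sets and boundedness is a consequence of regularity,
  not part of its definition.
\<close>

locale ahlfors_regular = metric_measure_space M
  for M :: "'a::{metric_space, second_countable_topology} measure" and \<delta> :: real +
  assumes dim_pos: "0 < \<delta>"
    and regular: "\<exists>C\<ge>1. \<forall>x r. 0 \<le> r \<longrightarrow>
      ereal r < (SUP y :: 'a. SUP z :: 'a. ereal (dist y z)) \<longrightarrow>
      r powr \<delta> / C \<le> measure M (cball x r) \<and> measure M (cball x r) \<le> C * r powr \<delta>"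

text \<open>
  \<open>L\<^sup>2(X, \<mu>)\<close> consists of the almost-everywhere classes \<open>L2_class M f\<close> of the functions
  \<open>f \<in> square_integrable M\<close>.
\<close>

definition square_integrable :: "'a measure \<Rightarrow> ('a \<Rightarrow> real) set" where
  "square_integrable M = {f \<in> borel_measurable M. integrable M (\<lambda>x. (f x)\<^sup>2)}"

definition L2_class :: "'a measure \<Rightarrow> ('a \<Rightarrow> real) \<Rightarrow> ('a \<Rightarrow> real) set" where
  "L2_class M f = {g \<in> square_integrable M. AE x in M. g x = f x}"

text \<open>
  The form and its domain are given on representatives; both are invariant under
  almost-everywhere equality.
\<close>

definition form_dom :: "'a::metric_space measure \<Rightarrow> real \<Rightarrow> ('a \<Rightarrow> real) set" where
  "form_dom M \<delta> = {f \<in> square_integrable M.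
     (\<integral>\<^sup>+x. (\<integral>\<^sup>+y\<in>-{x}. ennreal (\<bar>f x - f y\<bar>\<^sup>2 / dist x y powr \<delta>) \<partial>M) \<partial>M) < \<infinity>}"

definition form :: "'a::metric_space measure \<Rightarrow> real \<Rightarrow> ('a \<Rightarrow> real) \<Rightarrow> ('a \<Rightarrow> real) \<Rightarrow> real" where
  "form M \<delta> f g =
     1 / 2 * (LINT x|M. (LINT y:-{x}|M. (f x - f y) * (g x - g y) / dist x y powr \<delta>))"

text \<open>
  Operators on \<open>L\<^sup>2\<close> are represented by their graphs. The form being closed, \<open>resolvent\<close> is
  the graph of an everywhere defined map \<open>R\<close>; the form being densely defined, \<open>R\<close> is injective
  and \<open>laplacian = {(R f, f - R f) | f. f \<in> L\<^sup>2}\<close> is again the graph of a map, with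
  domain the range of \<open>R\<close>.
\<close>

definition resolvent ::
    "'a::metric_space measure \<Rightarrow> real \<Rightarrow> (('a \<Rightarrow> real) set \<times> ('a \<Rightarrow> real) set) set" where
  "resolvent M \<delta> = {(L2_class M f, L2_class M u) | f u.
     f \<in> square_integrable M \<and> u \<in> form_dom M \<delta> \<and>
     (\<forall>g\<in>form_dom M \<delta>. (LINT x|M. u x * g x) + form M \<delta> u g = (LINT x|M. f x * g x))}"

definition laplacian ::
    "'a::metric_space measure \<Rightarrow> real \<Rightarrow> (('a \<Rightarrow> real) set \<times> ('a \<Rightarrow> real) set) set" where
  "laplacian M \<delta> = {(L2_class M u, L2_class M (\<lambda>x. f x - u x)) | f u.
     f \<in> square_integrable M \<and> u \<in> square_integrable M \<and>
     (L2_class M f, L2_class M u) \<in> resolvent M \<delta>}"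

definition smooth_vectors :: "('b \<times> 'b) set \<Rightarrow> 'b set" where
  "smooth_vectors A = (\<Inter>n\<in>{1::nat..}. Domain (A ^^ n))"

definition holder_below :: "real \<Rightarrow> ('a::metric_space \<Rightarrow> real) set" where
  "holder_below \<alpha> = {f. bounded (range f) \<and> uniformly_continuous_on UNIV f \<and>
     (\<forall>\<beta>. 0 < \<beta> \<and> \<beta> < \<alpha> \<longrightarrow> (\<exists>C. \<forall>x y. \<bar>f x - f y\<bar> \<le> C * dist x y powr \<beta>))}"

end

theory Submission
  imports Defs
begin

text \<open>
  On a Hoelder function the Laplacian is the absolutely convergent singular integral
  $(Lf)(x) = \int (f(x) - f(y))\, d(x,y)^{-\delta}\, d\mu(y)$, and everything rests on the fact that
  an arbitrarily small positive power of the distance makes the kernel integrable, uniformly in the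
  base point: $\sup_x \int d(x,y)^{\epsilon - \delta}\, d\mu(y) < \infty$ for every $\epsilon > 0$
  (\<open>kernel_nn_integral_bound\<close>).  The dyadic annulus of radius about $2^{-n}R$ carries mass at most
  a constant times $2^{-n\delta}$ and hence contributes at most a constant times $2^{-n\epsilon}$.

  The operator $L$ loses an arbitrarily small part of the Hoelder exponent, which does no harm to
  functions that are Hoelder of every order below $\alpha$.  If $f$ is $(\gamma+\epsilon)$-Hoelder,
  then the integrands of $(Lf)(x)$ and $(Lf)(z)$ differ pointwise by at most a constant times
  $d(x,z)^\gamma \, (d(x,y)^{\epsilon-\delta} + d(z,y)^{\epsilon-\delta})$
  (\<open>kernel_difference_bound\<close>); integrating in $y$ gives \<open>pointwise_laplacian_holder\<close>.

  It remains to identify $L$ with the operator of the form.  For Hoelder $f$ and any $g \in L^2$,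
  Fubini and the symmetry of the kernel give $\mathcal{E}(f,g) = \langle Lf, g\rangle$
  (\<open>form_eq_pointwise_laplacian\<close>), so the class of $Lf$ is a value of the Laplacian at the class
  of $f$.  It is the only one, because bounded Lipschitz functions lie in the domain of the form
  and separate $L^2$ (\<open>AE_zero_of_Lipschitz_tests\<close>).  Invariance of the Hoelder space then lets
  the operator be iterated, which is the inclusion in the smooth vectors.

  Throughout, \<open>0 powr t = 0\<close> and \<open>t / 0 = 0\<close> make the kernels vanish on the diagonal,
  so integrals over the complement of a point are written over the whole space.
\<close>

section \<open>The singular integral and elementary estimates\<close>

definition pointwise_laplacian :: "'a::metric_space measure \<Rightarrow> real \<Rightarrow> ('a \<Rightarrow> real) \<Rightarrow> 'a \<Rightarrow> real" where
  "pointwise_laplacian M \<delta> f x = (LINT y|M. (f x - f y) / dist x y powr \<delta>)"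

lemma powr_neg_Lipschitz:
  fixes a b m \<delta> :: real
  assumes "0 < m" "m \<le> a" "m \<le> b" "0 < \<delta>"
  shows "\<bar>a powr - \<delta> - b powr - \<delta>\<bar> \<le> \<delta> * m powr (- \<delta> - 1) * \<bar>a - b\<bar>"
proof -
  have "norm (a powr - \<delta> - b powr - \<delta>) \<le> (\<delta> * m powr (- \<delta> - 1)) * norm (a - b)"
  proof (rule field_differentiable_bound[where S = "{m..}" and f' = "\<lambda>t. - \<delta> * t powr (- \<delta> - 1)"])
    fix t assume "t \<in> {m..}"
    then have t: "m \<le> t" "0 < t" using assms by auto
    show "((\<lambda>z. z powr - \<delta>) has_field_derivative - \<delta> * t powr (- \<delta> - 1)) (at t within {m..})"
      by (rule has_field_derivative_at_within, rule has_real_derivative_powr) (use t in auto)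
    have "t powr (- \<delta> - 1) \<le> m powr (- \<delta> - 1)"
      using t assms by (intro powr_mono2') auto
    then show "norm (- \<delta> * t powr (- \<delta> - 1)) \<le> \<delta> * m powr (- \<delta> - 1)"
      using assms by (simp add: abs_mult)
  qed (use assms in auto)
  then show ?thesis by simp
qed

text \<open>
  Here \<open>a\<close> and \<open>b\<close> are the distances from \<open>y\<close> to two points at distance \<open>r\<close>, and \<open>u\<close>, \<open>v\<close> are
  the increments of a Hoelder function.  When \<open>y\<close> is within a multiple of \<open>r\<close>, both
  terms are small separately.  When \<open>y\<close> is far away, the increments differ by little and the kernel
  is Lipschitz at scale \<open>b\<close>, which gains a factor \<open>r / b\<close>; since \<open>r < b\<close> and \<open>\<gamma> \<le> 1\<close>, this factor
  is at most \<open>(r / b) powr \<gamma>\<close>.  Trading \<open>\<epsilon>\<close> of the exponent for integrability replaces the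
  logarithm that a bound with exponent \<open>\<gamma> + \<epsilon>\<close> would produce.
\<close>

lemma kernel_difference_bound:
  fixes a b r u v C \<gamma> \<epsilon> \<delta> :: real
  assumes nonneg: "0 \<le> a" "0 \<le> b" and r: "0 < r" and tri: "\<bar>a - b\<bar> \<le> r"
    and pos: "0 < \<gamma>" "\<gamma> \<le> 1" "0 < \<epsilon>" "0 < \<delta>" "0 \<le> C"
    and u: "\<bar>u\<bar> \<le> C * a powr (\<gamma> + \<epsilon>)" and v: "\<bar>v\<bar> \<le> C * b powr (\<gamma> + \<epsilon>)"
    and uv: "\<bar>u - v\<bar> \<le> C * r powr (\<gamma> + \<epsilon>)"
  shows "\<bar>u / a powr \<delta> - v / b powr \<delta>\<bar>
    \<le> C * (3 powr \<gamma> + 1 + \<delta> * 2 powr (\<delta> + 1)) * r powr \<gamma> * (a powr (\<epsilon> - \<delta>) + b powr (\<epsilon> - \<delta>))"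
proof -
  define A B where "A = a powr (\<epsilon> - \<delta>)" and "B = b powr (\<epsilon> - \<delta>)"
  define K where "K = \<delta> * 2 powr (\<delta> + 1)"
  have AB: "0 \<le> A" "0 \<le> B" "0 \<le> K" by (auto simp: A_def B_def K_def pos less_imp_le)
  have "\<bar>u / a powr \<delta> - v / b powr \<delta>\<bar> \<le> C * (3 powr \<gamma> + 1 + K) * r powr \<gamma> * (A + B)"
  proof (cases "a \<le> 2 * r")
    case True
    \<comment> \<open>Both distances are at most \<open>3 * r\<close>, so \<open>\<gamma>\<close> of the exponent can be moved to \<open>r\<close>.\<close>
    have close: "\<bar>w / c powr \<delta>\<bar> \<le> C * 3 powr \<gamma> * r powr \<gamma> * c powr (\<epsilon> - \<delta>)"
      if "0 \<le> c" "c \<le> 3 * r" "\<bar>w\<bar> \<le> C * c powr (\<gamma> + \<epsilon>)" for c w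
    proof -
      have "\<bar>w / c powr \<delta>\<bar> \<le> C * c powr (\<gamma> + \<epsilon>) / c powr \<delta>"
        using that by (simp add: abs_divide divide_right_mono)
      also have "\<dots> = C * (c powr \<gamma> * c powr (\<epsilon> - \<delta>))"
        by (simp add: powr_add powr_diff)
      also have "\<dots> \<le> C * ((3 * r) powr \<gamma> * c powr (\<epsilon> - \<delta>))"
        using that pos by (intro mult_left_mono mult_right_mono powr_mono2) auto
      finally show ?thesis using r by (simp add: powr_mult mult_ac)
    qed
    have "\<bar>u / a powr \<delta> - v / b powr \<delta>\<bar> \<le> \<bar>u / a powr \<delta>\<bar> + \<bar>v / b powr \<delta>\<bar>" by linarith
    also have "\<dots> \<le> C * 3 powr \<gamma> * r powr \<gamma> * A + C * 3 powr \<gamma> * r powr \<gamma> * B"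
      unfolding A_def B_def
      using True tri nonneg u v r by (intro add_mono close) auto
    also have "\<dots> = C * 3 powr \<gamma> * r powr \<gamma> * (A + B)" by (simp add: algebra_simps)
    also have "\<dots> \<le> C * (3 powr \<gamma> + 1 + K) * r powr \<gamma> * (A + B)"
      using pos AB by (intro mult_right_mono mult_left_mono) auto
    finally show ?thesis .
  next
    case False
    then have far: "2 * r < a" "b / 2 \<le> a" "r < b" using tri r by linarith+
    have ab: "0 < a" "0 < b" using far r by auto
    have split: "u / a powr \<delta> - v / b powr \<delta> = (u - v) * a powr - \<delta> + v * (a powr - \<delta> - b powr - \<delta>)"
      using ab by (simp add: powr_minus divide_inverse algebra_simps)
    have "\<bar>u - v\<bar> * a powr - \<delta> \<le> C * r powr (\<gamma> + \<epsilon>) * a powr - \<delta>"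
      using uv by (intro mult_right_mono) auto
    also have "\<dots> = C * r powr \<gamma> * (r powr \<epsilon> * a powr - \<delta>)" by (simp add: powr_add)
    also have "\<dots> \<le> C * r powr \<gamma> * (a powr \<epsilon> * a powr - \<delta>)"
      using far r pos by (intro mult_left_mono mult_right_mono powr_mono2) auto
    also have "\<dots> = C * r powr \<gamma> * A" by (simp add: A_def flip: powr_add)
    finally have first: "\<bar>u - v\<bar> * a powr - \<delta> \<le> C * r powr \<gamma> * A" .
    have "\<bar>a powr - \<delta> - b powr - \<delta>\<bar> \<le> \<delta> * (b / 2) powr (- \<delta> - 1) * \<bar>a - b\<bar>"
      using far ab pos by (intro powr_neg_Lipschitz) auto
    also have "\<dots> \<le> \<delta> * (b / 2) powr (- \<delta> - 1) * r"
      using tri pos by (intro mult_left_mono) auto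
    also have "(b / 2) powr (- \<delta> - 1) = 2 powr (\<delta> + 1) * b powr (- \<delta> - 1)"
    proof -
      have e: "- \<delta> - 1 = - (\<delta> + 1)" by simp
      show ?thesis unfolding e powr_minus using ab by (simp add: powr_divide inverse_eq_divide)
    qed
    finally have diff: "\<bar>a powr - \<delta> - b powr - \<delta>\<bar> \<le> K * b powr (- \<delta> - 1) * r"
      by (simp add: K_def mult_ac)
    \<comment> \<open>The Lipschitz gain is a full power of \<open>r\<close>, of which only \<open>\<gamma>\<close> is kept.\<close>
    have "r powr 1 = r powr \<gamma> * r powr (1 - \<gamma>)"
      unfolding powr_add[symmetric] by simp
    also have "\<dots> \<le> r powr \<gamma> * b powr (1 - \<gamma>)"
      using far r pos by (intro mult_left_mono powr_mono2) auto
    finally have r_le: "r \<le> r powr \<gamma> * b powr (1 - \<gamma>)" using r by simp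
    have "\<bar>v\<bar> * \<bar>a powr - \<delta> - b powr - \<delta>\<bar>
        \<le> C * b powr (\<gamma> + \<epsilon>) * (K * b powr (- \<delta> - 1) * (r powr \<gamma> * b powr (1 - \<gamma>)))"
      using v diff r_le AB pos
      by (intro mult_mono order_trans[OF diff] mult_left_mono) auto
    also have "\<dots> = C * K * r powr \<gamma> * (b powr (\<gamma> + \<epsilon>) * b powr (- \<delta> - 1) * b powr (1 - \<gamma>))"
      by simp
    also have "b powr (\<gamma> + \<epsilon>) * b powr (- \<delta> - 1) * b powr (1 - \<gamma>) = B"
      by (simp add: B_def algebra_simps flip: powr_add)
    finally have second: "\<bar>v\<bar> * \<bar>a powr - \<delta> - b powr - \<delta>\<bar> \<le> C * K * r powr \<gamma> * B" .
    have "\<bar>u / a powr \<delta> - v / b powr \<delta>\<bar>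
        \<le> \<bar>u - v\<bar> * a powr - \<delta> + \<bar>v\<bar> * \<bar>a powr - \<delta> - b powr - \<delta>\<bar>"
      unfolding split by (rule order_trans[OF abs_triangle_ineq]) (simp add: abs_mult)
    also have "\<dots> \<le> C * 1 * r powr \<gamma> * A + C * K * r powr \<gamma> * B"
      using first second by simp
    also have "\<dots> \<le> C * (3 powr \<gamma> + 1 + K) * r powr \<gamma> * A + C * (3 powr \<gamma> + 1 + K) * r powr \<gamma> * B"
      using AB pos by (intro add_mono mult_right_mono mult_left_mono) auto
    finally show ?thesis by (simp add: algebra_simps)
  qed
  then show ?thesis by (simp add: A_def B_def K_def)
qed

lemma dyadic_scale_exists:
  fixes d R :: real
  assumes "0 < d" "d \<le> R"
  obtains n where "R / 2 ^ Suc n < d" "d \<le> R / 2 ^ n"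
proof -
  obtain k where "R / d < 2 ^ k" using real_arch_pow[of 2 "R / d"] by auto
  then have "R / 2 ^ k < d" using assms by (simp add: field_simps)
  then have ex: "\<exists>n. R / 2 ^ n < d" by blast
  define m where "m = (LEAST n. R / 2 ^ n < d)"
  have m: "R / 2 ^ m < d" unfolding m_def by (rule LeastI_ex[OF ex])
  then obtain n where n: "m = Suc n" using assms by (cases m) auto
  have "\<not> R / 2 ^ n < d" using not_less_Least[of n "\<lambda>n. R / 2 ^ n < d"] n m_def by simp
  then show ?thesis using that[of n] m n by simp
qed

lemma uniformly_continuous_of_holder:
  fixes f :: "'a::metric_space \<Rightarrow> real"
  assumes \<beta>: "0 < \<beta>" and hol: "\<exists>C. \<forall>x y. \<bar>f x - f y\<bar> \<le> C * dist x y powr \<beta>"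
  shows "uniformly_continuous_on UNIV f"
proof -
  obtain C where C: "\<And>x y. \<bar>f x - f y\<bar> \<le> C * dist x y powr \<beta>" using hol by blast
  define C' where "C' = \<bar>C\<bar> + 1"
  have C': "0 < C'" "C \<le> C'" by (auto simp: C'_def)
  show ?thesis unfolding uniformly_continuous_on_def
  proof (intro allI impI)
    fix e :: real assume e: "0 < e"
    define d where "d = (e / C') powr (1 / \<beta>)"
    have "dist (f y) (f x) < e" if "dist y x < d" for x y
    proof -
      have "\<bar>f y - f x\<bar> \<le> C' * dist y x powr \<beta>"
        using C[of y x] mult_right_mono[OF C'(2), of "dist y x powr \<beta>"] by simp
      also have "\<dots> < C' * d powr \<beta>" using that C' \<beta> by (simp add: powr_less_mono2)
      also have "\<dots> = e" using e C' \<beta> by (simp add: d_def powr_powr)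
      finally show ?thesis by (simp add: dist_real_def)
    qed
    moreover have "0 < d" using e C' by (simp add: d_def)
    ultimately show "\<exists>d>0. \<forall>x\<in>UNIV. \<forall>x'\<in>UNIV. dist x' x < d \<longrightarrow> dist (f x') (f x) < e" by auto
  qed
qed

section \<open>Measurability and volume growth\<close>

context ahlfors_regular
begin

lemma space_M: "space M = UNIV"
  by (metis borel_sets sets_eq_imp_space_eq space_borel)

lemma borel_measurable_iff_borel: "borel_measurable M = borel_measurable borel"
  by (rule measurable_cong_sets[OF borel_sets refl])

lemma pair_borel: "borel_measurable (M \<Otimes>\<^sub>M M) = borel_measurable borel"
proof -
  have "sets (M \<Otimes>\<^sub>M M) = sets (borel \<Otimes>\<^sub>M borel :: ('a \<times> 'a) measure)"
    by (rule sets_pair_measure_cong[OF borel_sets borel_sets])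
  then have "sets (M \<Otimes>\<^sub>M M) = sets (borel :: ('a \<times> 'a) measure)"
    unfolding borel_prod .
  then show ?thesis by (rule measurable_cong_sets[OF _ refl])
qed

text \<open>
  Second countability of the space is what makes the distance jointly measurable: it turns the
  product of the Borel sigma-algebras into the Borel sigma-algebra of the product.
\<close>

lemma borel_measurable_dist_pair [measurable]:
  "(\<lambda>p. dist (fst p) (snd p)) \<in> borel_measurable (M \<Otimes>\<^sub>M M)"
  unfolding pair_borel by (intro borel_measurable_continuous_onI continuous_intros)

lemma borel_measurable_dist_right [measurable]: "dist x \<in> borel_measurable M"
  unfolding borel_measurable_iff_borel by (intro borel_measurable_continuous_onI continuous_intros)

text \<open>
  Regularity controls radii below the diameter only.  The lower bound forces the diameter to be
  finite, as the measure is finite; for radii beyond the diameter the upper bound then survives with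
  a constant enlarged in terms of the total mass.  On a one-point space there are no radii
  to speak of and the point may carry mass, so that case has to be excluded.
\<close>

lemma ball_growth:
  assumes nontrivial: "\<exists>x y :: 'a. x \<noteq> y"
  obtains C R where "0 < C" "0 < R" "\<And>x y :: 'a. dist x y \<le> R"
    "\<And>x r. 0 < r \<Longrightarrow> measure M (cball x r) \<le> C * r powr \<delta>"
proof -
  define D where "D = (SUP y :: 'a. SUP z :: 'a. ereal (dist y z))"
  have dist_le: "ereal (dist y z) \<le> D" for y z :: 'a
    unfolding D_def by (intro SUP_upper2[of y] SUP_upper2[of z]) auto
  obtain C where C: "C \<ge> 1" and reg: "\<And>x r. 0 \<le> r \<Longrightarrow> ereal r < D \<Longrightarrow>
      r powr \<delta> / C \<le> measure M (cball x r) \<and> measure M (cball x r) \<le> C * r powr \<delta>"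
    using regular unfolding D_def by blast
  have le_total: "measure M (cball x r) \<le> measure M (space M)" for x r
    by (rule bounded_measure)
  have "D \<noteq> \<infinity>"
  proof
    assume "D = \<infinity>"
    \<comment> \<open>A ball of radius \<open>t powr (1 / \<delta>)\<close> would have measure exceeding the total mass.\<close>
    define t where "t = C * measure M (space M) + 1"
    have t: "0 < t" unfolding t_def using C by (intro add_nonneg_pos mult_nonneg_nonneg) auto
    have "(t powr (1 / \<delta>)) powr \<delta> / C \<le> measure M (cball undefined (t powr (1 / \<delta>)))"
      using reg[of "t powr (1 / \<delta>)" undefined] \<open>D = \<infinity>\<close> by simp
    also have "\<dots> \<le> measure M (space M)" by (rule le_total)
    finally have "t \<le> C * measure M (space M)"
      using C t dim_pos by (simp add: powr_powr field_simps)
    then show False by (simp add: t_def)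
  qed
  moreover obtain x y :: 'a where "x \<noteq> y" using nontrivial by blast
  then have "0 < ereal (dist x y)" by simp
  then have "0 < D" using dist_le[of x y] by (rule less_le_trans)
  ultimately obtain R where R: "D = ereal R" "0 < R" by (cases D) auto
  define C' where "C' = max C (measure M (space M) / R powr \<delta>)"
  have C': "C \<le> C'" "measure M (space M) / R powr \<delta> \<le> C'" by (auto simp: C'_def)
  show ?thesis
  proof (rule that)
    show "0 < C'" using C C' by linarith
    show "0 < R" by fact
    show "dist x y \<le> R" for x y :: 'a using dist_le[of x y] R by simp
    fix x and r :: real assume r: "0 < r"
    show "measure M (cball x r) \<le> C' * r powr \<delta>"
    proof (cases "r < R")
      case True
      then have "measure M (cball x r) \<le> C * r powr \<delta>" using reg[of r x] r R by simp
      also have "\<dots> \<le> C' * r powr \<delta>" using C' by (intro mult_right_mono) auto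
      finally show ?thesis .
    next
      case False
      have "measure M (cball x r) \<le> measure M (space M) / R powr \<delta> * R powr \<delta>"
        using le_total R by simp
      also have "\<dots> \<le> C' * r powr \<delta>"
        using C C' False R dim_pos by (intro mult_mono powr_mono2) auto
      finally show ?thesis .
    qed
  qed
qed

section \<open>Uniform integrability of the kernel\<close>

text \<open>
  The kernel is dominated by a sum over dyadic balls about \<open>x\<close>, in which the ball of radius
  \<open>s n\<close> appears, up to a constant, with the weight \<open>s n powr (\<epsilon> - \<delta>)\<close>.  Growth of balls turns the \<open>n\<close>-th term into a
  multiple of \<open>s n powr \<epsilon>\<close>, a geometric sequence with ratio below one.
\<close>

lemma kernel_nn_integral_bound:
  assumes \<epsilon>: "0 < \<epsilon>"
  obtains K where "0 \<le> K" "\<And>x. (\<integral>\<^sup>+y. ennreal (dist x y powr (\<epsilon> - \<delta>)) \<partial>M) \<le> ennreal K"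
proof (cases "\<exists>x y :: 'a. x \<noteq> y")
  case False
  then have "dist x y = 0" for x y :: 'a by (metis dist_self)
  then have "(\<integral>\<^sup>+y. ennreal (dist x y powr (\<epsilon> - \<delta>)) \<partial>M) = 0" for x by (simp only: powr_0 ennreal_0 nn_integral_const mult_zero_left)
  then show ?thesis by (intro that[of 0]) simp_all
next
  case True
  then obtain C R where C: "0 < C" and R: "0 < R" and diam: "\<And>x y :: 'a. dist x y \<le> R"
    and growth: "\<And>x r. 0 < r \<Longrightarrow> measure M (cball x r) \<le> C * r powr \<delta>"
    by (rule ball_growth) blast
  define s where "s n = R / 2 ^ n" for n
  have s: "0 < s n" for n using R by (simp add: s_def)
  \<comment> \<open>On an annulus the distance varies by a factor \<open>2\<close>, hence the kernel by at most \<open>2 powr \<delta>\<close>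
    when its exponent is negative; \<open>c \<ge> 1\<close> also covers the other sign.\<close>
  define c where "c = (2::real) powr \<delta>"
  have c: "0 \<le> c" "1 \<le> c" unfolding c_def using dim_pos by (auto intro: ge_one_powr_ge_zero)
  define q where "q = (1/2::real) powr \<epsilon>"
  have q: "0 \<le> q" "q < 1"
    unfolding q_def using \<epsilon> powr_less_mono2[of \<epsilon> "1/2" 1] by auto
  have s_powr: "s n powr \<epsilon> = R powr \<epsilon> * q ^ n" for n
  proof -
    have "s n powr \<epsilon> = R powr \<epsilon> * ((1/2) ^ n) powr \<epsilon>"
      using R by (simp add: s_def power_one_over powr_mult[symmetric])
    also have "((1/2::real) ^ n) powr \<epsilon> = q ^ n"
      by (simp add: q_def powr_powr mult.commute
          flip: powr_realpow[of "1/2"] powr_realpow[of "(1/2) powr \<epsilon>"])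
    finally show ?thesis .
  qed
  define g where "g n = c * C * R powr \<epsilon> * q ^ n" for n
  have g: "0 \<le> g n" for n using c C q by (simp add: g_def)
  have sum_g: "summable g" unfolding g_def using q by (intro summable_mult summable_geometric) auto
  show ?thesis
  proof (rule that)
    show "0 \<le> suminf g" using sum_g g by (intro suminf_nonneg) auto
    fix x :: 'a
    have pointwise: "ennreal (dist x y powr (\<epsilon> - \<delta>))
        \<le> (\<Sum>n. ennreal (c * s n powr (\<epsilon> - \<delta>)) * indicator (cball x (s n)) y)" for y
    proof (cases "x = y")
      case False
      then have d: "0 < dist x y" by simp
      obtain n where n: "R / 2 ^ Suc n < dist x y" "dist x y \<le> R / 2 ^ n"
        using dyadic_scale_exists[OF d diam] by blast
      have n': "s n / 2 \<le> dist x y" "dist x y \<le> s n" using n by (auto simp: s_def field_simps)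
      have "dist x y powr (\<epsilon> - \<delta>) \<le> c * s n powr (\<epsilon> - \<delta>)"
      proof (cases "\<delta> \<le> \<epsilon>")
        case True
        then have "dist x y powr (\<epsilon> - \<delta>) \<le> 1 * s n powr (\<epsilon> - \<delta>)"
          using n' by (simp add: powr_mono2)
        also have "\<dots> \<le> c * s n powr (\<epsilon> - \<delta>)" using c by (intro mult_right_mono) auto
        finally show ?thesis .
      next
        case False
        then have "dist x y powr (\<epsilon> - \<delta>) \<le> (s n / 2) powr (\<epsilon> - \<delta>)"
          using n' s[of n] by (intro powr_mono2') auto
        also have "\<dots> = 2 powr (\<delta> - \<epsilon>) * s n powr (\<epsilon> - \<delta>)"
        proof -
          have e: "\<epsilon> - \<delta> = - (\<delta> - \<epsilon>)" by simp
          show ?thesis unfolding e powr_minus using s[of n] by (simp add: powr_divide inverse_eq_divide)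
        qed
        also have "\<dots> \<le> c * s n powr (\<epsilon> - \<delta>)"
          unfolding c_def using \<epsilon> by (intro mult_right_mono powr_mono) auto
        finally show ?thesis .
      qed
      then have "ennreal (dist x y powr (\<epsilon> - \<delta>))
          \<le> ennreal (c * s n powr (\<epsilon> - \<delta>)) * indicator (cball x (s n)) y"
        using n' by (simp add: ennreal_leI)
      also have "\<dots> = (\<Sum>i\<in>{n}. ennreal (c * s i powr (\<epsilon> - \<delta>)) * indicator (cball x (s i)) y)"
        by (simp only: sum.insert sum.empty finite.emptyI empty_iff not_False_eq_True add_0_right)
      also have "\<dots> \<le> (\<Sum>i. ennreal (c * s i powr (\<epsilon> - \<delta>)) * indicator (cball x (s i)) y)"
        by (rule sum_le_suminf) auto
      finally show ?thesis .
    qed simp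
    have ballM: "cball x t \<in> sets M" for t by (simp add: borel_sets)
    have "(\<integral>\<^sup>+y. ennreal (dist x y powr (\<epsilon> - \<delta>)) \<partial>M)
        \<le> (\<integral>\<^sup>+y. (\<Sum>n. ennreal (c * s n powr (\<epsilon> - \<delta>)) * indicator (cball x (s n)) y) \<partial>M)"
      by (intro nn_integral_mono pointwise)
    also have "\<dots> = (\<Sum>n. \<integral>\<^sup>+y. ennreal (c * s n powr (\<epsilon> - \<delta>)) * indicator (cball x (s n)) y \<partial>M)"
      using ballM by (intro nn_integral_suminf) auto
    also have "\<dots> = (\<Sum>n. ennreal (c * s n powr (\<epsilon> - \<delta>)) * ennreal (measure M (cball x (s n))))"
      using ballM by (simp add: nn_integral_cmult_indicator emeasure_eq_measure)
    also have "\<dots> \<le> (\<Sum>n. ennreal (g n))"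
    proof (intro suminf_le summableI)
      fix n
      have "c * s n powr (\<epsilon> - \<delta>) * measure M (cball x (s n)) \<le> c * s n powr (\<epsilon> - \<delta>) * (C * s n powr \<delta>)"
        using c growth[OF s] by (intro mult_left_mono) auto
      also have "\<dots> = c * C * (s n powr (\<epsilon> - \<delta>) * s n powr \<delta>)" by simp
      also have "\<dots> = g n" by (simp add: g_def s_powr flip: powr_add)
      finally show "ennreal (c * s n powr (\<epsilon> - \<delta>)) * ennreal (measure M (cball x (s n))) \<le> ennreal (g n)"
        using c by (simp add: ennreal_leI flip: ennreal_mult)
    qed
    also have "\<dots> = ennreal (suminf g)" using sum_g g by (intro suminf_ennreal2) auto
    finally show "(\<integral>\<^sup>+y. ennreal (dist x y powr (\<epsilon> - \<delta>)) \<partial>M) \<le> ennreal (suminf g)" .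
  qed
qed

lemma kernel_integral_bound:
  assumes \<epsilon>: "0 < \<epsilon>"
  obtains K where "0 \<le> K" "\<And>x. integrable M (\<lambda>y. dist x y powr (\<epsilon> - \<delta>))"
    "\<And>x. (LINT y|M. dist x y powr (\<epsilon> - \<delta>)) \<le> K"
proof -
  obtain K where K: "0 \<le> K" "\<And>x. (\<integral>\<^sup>+y. ennreal (dist x y powr (\<epsilon> - \<delta>)) \<partial>M) \<le> ennreal K"
    using kernel_nn_integral_bound[OF \<epsilon>] by blast
  have int: "integrable M (\<lambda>y. dist x y powr (\<epsilon> - \<delta>))" for x
  proof (rule integrableI_bounded)
    show "(\<integral>\<^sup>+y. ennreal (norm (dist x y powr (\<epsilon> - \<delta>))) \<partial>M) < \<infinity>"
      using K(2)[of x] by (simp add: le_less_trans)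
  qed measurable
  moreover have "(LINT y|M. dist x y powr (\<epsilon> - \<delta>)) \<le> K" for x
    using K(2)[of x] K(1) nn_integral_eq_integral[OF int] by simp
  ultimately show ?thesis using that K(1) by blast
qed


section \<open>The singular integral preserves the Hoelder space\<close>

lemma kernel_quotient_bound:
  assumes "\<And>x y. \<bar>f x - f y\<bar> \<le> C * dist x y powr \<beta>"
  shows "\<bar>(f x - f y) / dist x y powr \<delta>\<bar> \<le> C * dist x y powr (\<beta> - \<delta>)"
  using divide_right_mono[OF assms[of x y], of "dist x y powr \<delta>"]
  by (simp add: abs_divide powr_diff)

lemma borel_measurable_of_holder:
  assumes "0 < \<beta>" "\<And>x y. \<bar>f x - f y\<bar> \<le> C * dist x y powr \<beta>"
  shows "f \<in> borel_measurable M"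
proof -
  have "isCont f x" for x
  proof -
    have lim: "((\<lambda>y. C * dist y x powr \<beta>) \<longlongrightarrow> C * 0 powr \<beta>) (at x)"
      using assms(1) by (intro tendsto_intros tendsto_powr') (auto intro!: tendsto_eq_intros)
    have "((\<lambda>y. f y - f x) \<longlongrightarrow> 0) (at x)"
      by (rule Lim_null_comparison[OF _ lim[simplified]]) (use assms(2) in auto)
    then show ?thesis by (simp add: isCont_def LIM_zero_iff)
  qed
  then show ?thesis unfolding borel_measurable_iff_borel
    by (intro borel_measurable_continuous_onI continuous_at_imp_continuous_on) auto
qed

lemma quotient_integrable:
  assumes "0 < \<beta>" and hol: "\<And>x y. \<bar>f x - f y\<bar> \<le> C * dist x y powr \<beta>"
  shows "integrable M (\<lambda>y. (f x - f y) / dist x y powr \<delta>)"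
proof -
  have [measurable]: "f \<in> borel_measurable M" by (rule borel_measurable_of_holder[OF assms])
  obtain K where K: "\<And>x. integrable M (\<lambda>y. dist x y powr (\<beta> - \<delta>))"
    using kernel_integral_bound[OF assms(1)] by blast
  show ?thesis
  proof (rule Bochner_Integration.integrable_bound)
    show "integrable M (\<lambda>y. C * dist x y powr (\<beta> - \<delta>))" using K by simp
    show "AE y in M. norm ((f x - f y) / dist x y powr \<delta>) \<le> norm (C * dist x y powr (\<beta> - \<delta>))"
      unfolding real_norm_def
      by (intro AE_I2 order_trans[OF kernel_quotient_bound[OF hol] abs_ge_self])
  qed measurable
qed

lemma pointwise_laplacian_bounded:
  assumes "0 < \<beta>" and hol: "\<And>x y. \<bar>f x - f y\<bar> \<le> C * dist x y powr \<beta>"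
  shows "bounded (range (pointwise_laplacian M \<delta> f))"
proof -
  obtain K where K: "0 \<le> K" "\<And>x. integrable M (\<lambda>y. dist x y powr (\<beta> - \<delta>))"
    "\<And>x. (LINT y|M. dist x y powr (\<beta> - \<delta>)) \<le> K"
    using kernel_integral_bound[OF assms(1)] by blast
  have "\<bar>pointwise_laplacian M \<delta> f x\<bar> \<le> \<bar>C\<bar> * K" for x
  proof -
    have "\<bar>pointwise_laplacian M \<delta> f x\<bar> \<le> (LINT y|M. \<bar>C\<bar> * dist x y powr (\<beta> - \<delta>))"
      unfolding pointwise_laplacian_def
    proof (rule order_trans[OF integral_abs_bound integral_mono])
      show "integrable M (\<lambda>y. \<bar>(f x - f y) / dist x y powr \<delta>\<bar>)"
        using quotient_integrable[OF assms] by (rule integrable_abs)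
      show "\<bar>(f x - f y) / dist x y powr \<delta>\<bar> \<le> \<bar>C\<bar> * dist x y powr (\<beta> - \<delta>)" for y
        by (rule order_trans[OF kernel_quotient_bound[OF hol]]) (simp add: mult_right_mono)
    qed (use K(2)[of x] in simp)
    also have "\<dots> \<le> \<bar>C\<bar> * K" using K(3)[of x] by (simp add: mult_left_mono K(2))
    finally show ?thesis .
  qed
  then show ?thesis unfolding bounded_iff by (intro exI[of _ "\<bar>C\<bar> * K"]) auto
qed

text \<open>
  Integrating the pointwise comparison of the two kernels leaves only the two kernel integrals of
  positive order \<open>\<epsilon> = \<beta> - \<gamma>\<close>, which are bounded independently of the base points.
\<close>

lemma pointwise_laplacian_holder:
  assumes pos: "0 < \<gamma>" "\<gamma> < \<beta>" "\<gamma> \<le> 1" and hol: "\<And>x y. \<bar>f x - f y\<bar> \<le> C * dist x y powr \<beta>"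
  shows "\<exists>C'. \<forall>x z. \<bar>pointwise_laplacian M \<delta> f x - pointwise_laplacian M \<delta> f z\<bar> \<le> C' * dist x z powr \<gamma>"
proof -
  define \<epsilon> where "\<epsilon> = \<beta> - \<gamma>"
  have \<epsilon>: "0 < \<epsilon>" "\<beta> = \<gamma> + \<epsilon>" using pos by (auto simp: \<epsilon>_def)
  have hol': "\<bar>f x - f y\<bar> \<le> \<bar>C\<bar> * dist x y powr (\<gamma> + \<epsilon>)" for x y
    using hol[of x y] by (simp add: \<epsilon>(2)) (smt (verit) mult_right_mono powr_ge_zero)
  obtain K where K: "0 \<le> K" "\<And>x. integrable M (\<lambda>y. dist x y powr (\<epsilon> - \<delta>))"
    "\<And>x. (LINT y|M. dist x y powr (\<epsilon> - \<delta>)) \<le> K"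
    using kernel_integral_bound[OF \<epsilon>(1)] by blast
  define c where "c = \<bar>C\<bar> * (3 powr \<gamma> + 1 + \<delta> * 2 powr (\<delta> + 1))"
  have c: "0 \<le> c" using dim_pos by (simp add: c_def)
  have int: "integrable M (\<lambda>y. (f x - f y) / dist x y powr \<delta>)" for x
    using pos by (intro quotient_integrable[OF _ hol]) auto
  have "\<bar>pointwise_laplacian M \<delta> f x - pointwise_laplacian M \<delta> f z\<bar> \<le> c * (2 * K) * dist x z powr \<gamma>" for x z
  proof (cases "x = z")
    case False
    have "\<bar>pointwise_laplacian M \<delta> f x - pointwise_laplacian M \<delta> f z\<bar>
        = \<bar>LINT y|M. (f x - f y) / dist x y powr \<delta> - (f z - f y) / dist z y powr \<delta>\<bar>"
      unfolding pointwise_laplacian_def using int by simp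
    also have "\<dots> \<le> (LINT y|M. c * dist x z powr \<gamma> * (dist x y powr (\<epsilon> - \<delta>) + dist z y powr (\<epsilon> - \<delta>)))"
    proof (rule order_trans[OF integral_abs_bound integral_mono])
      fix y
      show "\<bar>(f x - f y) / dist x y powr \<delta> - (f z - f y) / dist z y powr \<delta>\<bar>
          \<le> c * dist x z powr \<gamma> * (dist x y powr (\<epsilon> - \<delta>) + dist z y powr (\<epsilon> - \<delta>))"
        unfolding c_def
      proof (rule kernel_difference_bound)
        show "\<bar>dist x y - dist z y\<bar> \<le> dist x z"
          using dist_triangle[of x y z] dist_triangle[of z y x] by (simp add: dist_commute)
        show "\<bar>f x - f y - (f z - f y)\<bar> \<le> \<bar>C\<bar> * dist x z powr (\<gamma> + \<epsilon>)"
          using hol'[of x z] by simp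
      qed (use False pos \<epsilon> dim_pos hol' in auto)
    qed (use int K in auto)
    also have "\<dots> = c * dist x z powr \<gamma> *
        ((LINT y|M. dist x y powr (\<epsilon> - \<delta>)) + (LINT y|M. dist z y powr (\<epsilon> - \<delta>)))"
      using K by simp
    also have "\<dots> \<le> c * dist x z powr \<gamma> * (2 * K)"
      using K(3)[of x] K(3)[of z] c by (intro mult_left_mono) auto
    finally show ?thesis by (simp add: mult_ac)
  qed (use pos in simp)
  then show ?thesis by blast
qed

text \<open>
  Every exponent below \<open>\<alpha>\<close> has another one between itself and \<open>\<alpha>\<close>, so the small loss of regularity
  is invisible in the intersection of the Hoelder classes.
\<close>

lemma pointwise_laplacian_in_holder_below:
  assumes \<alpha>: "0 < \<alpha>" "\<alpha> \<le> 1" and f: "f \<in> holder_below \<alpha>"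
  shows "pointwise_laplacian M \<delta> f \<in> holder_below \<alpha>"
proof -
  let ?L = "pointwise_laplacian M \<delta> f"
  have hol: "\<exists>C. \<forall>x y. \<bar>?L x - ?L y\<bar> \<le> C * dist x y powr \<gamma>" if \<gamma>: "0 < \<gamma>" "\<gamma> < \<alpha>" for \<gamma>
  proof -
    obtain \<beta> where \<beta>: "\<gamma> < \<beta>" "\<beta> < \<alpha>" using dense[OF \<gamma>(2)] by blast
    then obtain C where "\<And>x y. \<bar>f x - f y\<bar> \<le> C * dist x y powr \<beta>"
      using f \<gamma> unfolding holder_below_def by force
    then show ?thesis using \<gamma> \<beta> \<alpha> by (intro pointwise_laplacian_holder) auto
  qed
  have half: "0 < \<alpha> / 2" "\<alpha> / 2 < \<alpha>" using \<alpha> by auto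
  obtain C where "\<And>x y. \<bar>f x - f y\<bar> \<le> C * dist x y powr (\<alpha> / 2)"
    using f half unfolding holder_below_def by blast
  then have "bounded (range ?L)" by (rule pointwise_laplacian_bounded[OF half(1)])
  moreover have "uniformly_continuous_on UNIV ?L"
    by (rule uniformly_continuous_of_holder[OF half(1) hol[OF half]])
  ultimately show ?thesis using hol by (simp add: holder_below_def)
qed

section \<open>The form on Hoelder functions\<close>

lemma bounded_in_square_integrable:
  assumes [measurable]: "f \<in> borel_measurable M" and bdd: "bounded (range f)"
  shows "f \<in> square_integrable M"
proof -
  obtain B where "\<And>x. \<bar>f x\<bar> \<le> B" using bdd by (auto simp: bounded_iff)
  then have "\<bar>(f x)\<^sup>2\<bar> \<le> B\<^sup>2" for x by (simp add: abs_le_square_iff[symmetric] abs_le_iff) (smt (verit))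
  then show ?thesis
    unfolding square_integrable_def by (auto intro!: integrable_const_bound[where B = "B\<^sup>2"])
qed

text \<open>
  Squaring the increment doubles the Hoelder exponent, so the energy density is dominated by the
  kernel of order \<open>2 * \<beta>\<close>.
\<close>

lemma bounded_holder_in_form_dom:
  assumes "0 < \<beta>" and hol: "\<And>x y. \<bar>f x - f y\<bar> \<le> C * dist x y powr \<beta>" and bdd: "bounded (range f)"
  shows "f \<in> form_dom M \<delta>"
proof -
  have [measurable]: "f \<in> borel_measurable M" by (rule borel_measurable_of_holder[OF assms(1,2)])
  obtain K where K: "\<And>x. (\<integral>\<^sup>+y. ennreal (dist x y powr (2 * \<beta> - \<delta>)) \<partial>M) \<le> ennreal K"
    using kernel_nn_integral_bound[of "2 * \<beta>"] assms(1) by auto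
  have "(\<integral>\<^sup>+y\<in>-{x}. ennreal (\<bar>f x - f y\<bar>\<^sup>2 / dist x y powr \<delta>) \<partial>M) \<le> ennreal (C\<^sup>2) * ennreal K" for x
  proof -
    have le: "\<bar>f x - f y\<bar>\<^sup>2 / dist x y powr \<delta> \<le> C\<^sup>2 * dist x y powr (2 * \<beta> - \<delta>)" for y
    proof -
      have "\<bar>f x - f y\<bar>\<^sup>2 \<le> (C * dist x y powr \<beta>)\<^sup>2" using hol by (intro power_mono) auto
      also have "\<dots> = C\<^sup>2 * dist x y powr (2 * \<beta>)"
        by (simp add: power_mult_distrib power2_eq_square flip: powr_add)
      finally show ?thesis by (simp add: powr_diff divide_right_mono)
    qed
    have "(\<integral>\<^sup>+y\<in>-{x}. ennreal (\<bar>f x - f y\<bar>\<^sup>2 / dist x y powr \<delta>) \<partial>M)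
        \<le> (\<integral>\<^sup>+y. ennreal (C\<^sup>2) * ennreal (dist x y powr (2 * \<beta> - \<delta>)) \<partial>M)"
      using le by (intro nn_integral_mono)
        (auto simp: indicator_def ennreal_leI simp flip: ennreal_mult)
    also have "\<dots> = ennreal (C\<^sup>2) * (\<integral>\<^sup>+y. ennreal (dist x y powr (2 * \<beta> - \<delta>)) \<partial>M)"
      by (rule nn_integral_cmult) measurable
    also have "\<dots> \<le> ennreal (C\<^sup>2) * ennreal K" by (intro mult_left_mono K) auto
    finally show ?thesis .
  qed
  then have "(\<integral>\<^sup>+x. (\<integral>\<^sup>+y\<in>-{x}. ennreal (\<bar>f x - f y\<bar>\<^sup>2 / dist x y powr \<delta>) \<partial>M) \<partial>M)
      \<le> (\<integral>\<^sup>+x. ennreal (C\<^sup>2) * ennreal K \<partial>M)" by (intro nn_integral_mono)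
  also have "\<dots> < \<infinity>"
    by (simp add: emeasure_eq_measure ennreal_mult_less_top)
  finally show ?thesis using bounded_in_square_integrable[OF _ bdd] by (simp add: form_dom_def)
qed

lemma integrable_of_square_integrable:
  assumes "g \<in> square_integrable M"
  shows "integrable M g"
  using assms unfolding square_integrable_def by (blast intro: square_integrable_imp_integrable)

lemma measurable_pair_quotient:
  assumes [measurable]: "f \<in> borel_measurable M" "g \<in> borel_measurable M"
  shows "(\<lambda>p. (f (fst p) - f (snd p)) * g (fst p) / dist (fst p) (snd p) powr \<delta>)
    \<in> borel_measurable (M \<Otimes>\<^sub>M M)"
  by measurable

text \<open>
  The integrand of the form is \<open>G x y + G y x\<close>, where \<open>G\<close> keeps only the summand containing
  \<open>g x\<close>.  Because \<open>f\<close> is Hoelder, \<open>G\<close> alone is integrable on the product, although \<open>g\<close> is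
  merely square integrable; by symmetry both halves have the same integral, which cancels the
  factor \<open>1 / 2\<close>.
\<close>

lemma form_eq_pointwise_laplacian:
  assumes "0 < \<beta>" and hol: "\<And>x y. \<bar>f x - f y\<bar> \<le> C * dist x y powr \<beta>"
    and g: "g \<in> square_integrable M"
  shows "form M \<delta> f g = (LINT x|M. pointwise_laplacian M \<delta> f x * g x)"
proof -
  \<comment> \<open>Named here because the interpretation of the product hides the statement for \<open>M\<close> alone.\<close>
  note Tonelli = nn_integral_fst
  interpret pair_sigma_finite M M ..
  have fM [measurable]: "f \<in> borel_measurable M" by (rule borel_measurable_of_holder[OF assms(1,2)])
  have gM [measurable]: "g \<in> borel_measurable M" using g by (simp add: square_integrable_def)
  define G where "G = (\<lambda>x y. (f x - f y) * g x / dist x y powr \<delta>)"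
  have G_eq: "G x y = (f x - f y) / dist x y powr \<delta> * g x" for x y by (simp add: G_def)
  obtain K where K: "0 \<le> K" "\<And>x. (\<integral>\<^sup>+y. ennreal (dist x y powr (\<beta> - \<delta>)) \<partial>M) \<le> ennreal K"
    using kernel_nn_integral_bound[OF assms(1)] by blast
  have meas [measurable]: "case_prod G \<in> borel_measurable (M \<Otimes>\<^sub>M M)"
    using measurable_pair_quotient[OF fM gM] by (simp add: G_def case_prod_beta')
  have "integrable (M \<Otimes>\<^sub>M M) (case_prod G)"
  proof (rule integrableI_bounded[OF meas])
    have "(\<integral>\<^sup>+y. ennreal (norm (G x y)) \<partial>M) \<le> ennreal (\<bar>C\<bar> * K * \<bar>g x\<bar>)" for x
    proof -
      have "ennreal (norm (G x y)) \<le> ennreal (\<bar>C\<bar> * \<bar>g x\<bar>) * ennreal (dist x y powr (\<beta> - \<delta>))" for y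
      proof -
        have "\<bar>(f x - f y) / dist x y powr \<delta>\<bar> \<le> \<bar>C\<bar> * dist x y powr (\<beta> - \<delta>)"
          by (rule order_trans[OF kernel_quotient_bound[OF hol]]) (simp add: mult_right_mono)
        then have "\<bar>G x y\<bar> \<le> \<bar>C\<bar> * dist x y powr (\<beta> - \<delta>) * \<bar>g x\<bar>"
          unfolding G_eq abs_mult by (rule mult_right_mono) simp
        then show ?thesis by (simp add: ennreal_leI mult_ac flip: ennreal_mult)
      qed
      then have "(\<integral>\<^sup>+y. ennreal (norm (G x y)) \<partial>M)
          \<le> (\<integral>\<^sup>+y. ennreal (\<bar>C\<bar> * \<bar>g x\<bar>) * ennreal (dist x y powr (\<beta> - \<delta>)) \<partial>M)"
        by (rule nn_integral_mono)
      also have "\<dots> = ennreal (\<bar>C\<bar> * \<bar>g x\<bar>) * (\<integral>\<^sup>+y. ennreal (dist x y powr (\<beta> - \<delta>)) \<partial>M)"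
        by (rule nn_integral_cmult) measurable
      also have "\<dots> \<le> ennreal (\<bar>C\<bar> * \<bar>g x\<bar>) * ennreal K" by (intro mult_left_mono K) auto
      also have "\<dots> = ennreal (\<bar>C\<bar> * K * \<bar>g x\<bar>)" using K(1) by (simp add: mult_ac flip: ennreal_mult)
      finally show ?thesis .
    qed
    then have "(\<integral>\<^sup>+x. (\<integral>\<^sup>+y. ennreal (norm (G x y)) \<partial>M) \<partial>M) \<le> (\<integral>\<^sup>+x. ennreal (\<bar>C\<bar> * K * \<bar>g x\<bar>) \<partial>M)"
      by (rule nn_integral_mono)
    also have "\<dots> = ennreal (LINT x|M. \<bar>C\<bar> * K * \<bar>g x\<bar>)"
      using integrable_of_square_integrable[OF g] K(1) by (intro nn_integral_eq_integral) auto
    finally have "(\<integral>\<^sup>+x. (\<integral>\<^sup>+y. ennreal (norm (G x y)) \<partial>M) \<partial>M) < \<infinity>"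
      by (rule le_less_trans) simp
    then show "(\<integral>\<^sup>+p. ennreal (norm (case_prod G p)) \<partial>(M \<Otimes>\<^sub>M M)) < \<infinity>"
      using Tonelli[of "\<lambda>p. ennreal (norm (case_prod G p))" M] meas by simp
  qed
  note G_int = this
  have G_swap: "integrable (M \<Otimes>\<^sub>M M) (\<lambda>(x, y). G y x)"
    using integrable_product_swap[OF G_int] by simp
  have off_diagonal: "(LINT y:-{x}|M. (f x - f y) * (g x - g y) / dist x y powr \<delta>) = (LINT y|M. G x y + G y x)" for x
    unfolding set_lebesgue_integral_def
  proof (rule Bochner_Integration.integral_cong[OF refl])
    fix y
    have "(f x - f y) * g x + (f y - f x) * g y = (f x - f y) * (g x - g y)"
      by (simp add: algebra_simps)
    then have "G x y + G y x = (f x - f y) * (g x - g y) / dist x y powr \<delta>"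
      by (simp only: G_def dist_commute[of y x] add_divide_distrib[symmetric])
    then show "indicat_real (- {x}) y *\<^sub>R ((f x - f y) * (g x - g y) / dist x y powr \<delta>) = G x y + G y x"
      by (cases "y = x") auto
  qed
  have "form M \<delta> f g = 1 / 2 * (LINT x|M. (LINT y|M. G x y + G y x))"
    by (simp add: form_def off_diagonal)
  also have "(LINT x|M. (LINT y|M. G x y + G y x)) = integral\<^sup>L (M \<Otimes>\<^sub>M M) (\<lambda>(x, y). G x y + G y x)"
    using Bochner_Integration.integrable_add[OF G_int G_swap]
    by (intro integral_fst) (simp add: case_prod_beta')
  also have "\<dots> = integral\<^sup>L (M \<Otimes>\<^sub>M M) (case_prod G) + integral\<^sup>L (M \<Otimes>\<^sub>M M) (\<lambda>(x, y). G y x)"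
    using Bochner_Integration.integral_add[OF G_int G_swap] by (simp add: case_prod_beta')
  also have "integral\<^sup>L (M \<Otimes>\<^sub>M M) (\<lambda>(x, y). G y x) = integral\<^sup>L (M \<Otimes>\<^sub>M M) (case_prod G)"
    using integral_product_swap[OF meas] by simp
  also have "integral\<^sup>L (M \<Otimes>\<^sub>M M) (case_prod G) = (LINT x|M. (LINT y|M. G x y))"
    using integral_fst[OF G_int] by simp
  also have "\<dots> = (LINT x|M. pointwise_laplacian M \<delta> f x * g x)"
    by (simp only: G_eq pointwise_laplacian_def integral_mult_left_zero)
  finally show ?thesis by simp
qed

section \<open>Lipschitz functions separate classes\<close>

text \<open>
  Indicators of closed sets are decreasing limits of bounded Lipschitz functions of the distance to
  the set, so the integral of \<open>h\<close> vanishes over closed sets.  These form a generator of the Borel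
  sets that is stable under intersections, and the property extends to all of them.
\<close>

lemma AE_zero_of_Lipschitz_tests:
  assumes h: "integrable M h"
    and test: "\<And>g C. (\<And>x y. \<bar>g x - g y\<bar> \<le> C * dist x y) \<Longrightarrow> bounded (range g) \<Longrightarrow> (LINT x|M. h x * g x) = 0"
  shows "AE x in M. h x = 0"
proof (rule density_zero[OF h])
  have [measurable]: "h \<in> borel_measurable M" using h by simp
  have closed: "(LINT x:F|M. h x) = 0" if F: "closed F" for F
  proof (cases "F = {}")
    case False
    have FM [measurable]: "F \<in> sets M" using F by (simp add: borel_sets)
    define g where "g n x = max 0 (1 - real n * infdist x F)" for n x
    have g_bound: "0 \<le> g n x" "g n x \<le> 1" for n x by (auto simp: g_def infdist_nonneg)
    have [measurable]: "g n \<in> borel_measurable M" for n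
      unfolding borel_measurable_iff_borel g_def
      by (intro borel_measurable_continuous_onI continuous_intros)
    have g_test: "(LINT x|M. h x * g n x) = 0" for n
    proof (rule test)
      show "\<bar>g n x - g n y\<bar> \<le> real n * dist x y" for x y
      proof -
        have "\<bar>g n x - g n y\<bar> \<le> \<bar>real n * infdist x F - real n * infdist y F\<bar>" by (simp add: g_def)
        also have "\<dots> = real n * \<bar>infdist x F - infdist y F\<bar>"
          by (simp add: abs_mult flip: right_diff_distrib)
        also have "\<dots> \<le> real n * dist x y" by (intro mult_left_mono infdist_triangle_abs) simp
        finally show ?thesis .
      qed
      show "bounded (range (g n))" unfolding bounded_iff using g_bound by (auto intro!: exI[of _ 1])
    qed
    have "(\<lambda>n. LINT x|M. h x * g n x) \<longlonglongrightarrow> (LINT x|M. h x * indicator F x)"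
    proof (rule integral_dominated_convergence[where w = "\<lambda>x. \<bar>h x\<bar>"])
      show "integrable M (\<lambda>x. \<bar>h x\<bar>)" using h by simp
      show "AE x in M. norm (h x * g n x) \<le> \<bar>h x\<bar>" for n
        using g_bound by (simp add: abs_mult mult_left_le)
      show "AE x in M. (\<lambda>n. h x * g n x) \<longlonglongrightarrow> h x * indicator F x"
      proof (intro AE_I2 tendsto_mult_left)
        fix x
        show "(\<lambda>n. g n x) \<longlonglongrightarrow> indicator F x"
        proof (cases "x \<in> F")
          case False
          then have d: "0 < infdist x F" using F \<open>F \<noteq> {}\<close> by (intro infdist_pos_not_in_closed)
          obtain k where k: "1 < real k * infdist x F" using reals_Archimedean3[OF d] by blast
          have "g n x = 0" if "k \<le> n" for n
          proof -
            have "real k * infdist x F \<le> real n * infdist x F" using that d by (intro mult_right_mono) auto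
            then show ?thesis using k by (simp add: g_def)
          qed
          then have "\<forall>\<^sub>F n in sequentially. g n x = 0" using eventually_sequentially by blast
          then show ?thesis using False by (simp add: tendsto_eventually)
        qed (simp add: g_def)
      qed
    qed measurable
    then have "(LINT x|M. h x * indicator F x) = 0" using g_test by (simp add: LIMSEQ_const_iff)
    then show ?thesis by (simp add: set_lebesgue_integral_def mult.commute)
  qed (simp add: set_lebesgue_integral_def)
  fix A assume "A \<in> sets M"
  then have A: "A \<in> sigma_sets UNIV (Collect closed)"
    using borel_sets by (simp add: borel_eq_closed)
  have sigma_M: "sigma_sets UNIV (Collect closed) = sets M"
    using borel_sets by (simp add: borel_eq_closed)
  have set_int: "set_integrable M B h" if "B \<in> sets M" for B
    unfolding set_integrable_def by (rule integrable_mult_indicator[OF that h])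
  show "(LINT x:A|M. h x) = 0"
  proof (rule sigma_sets_induct_disjoint[OF _ _ A])
    show "Int_stable (Collect closed :: 'a set set)" by (auto simp: Int_stable_def)
    show "(LINT x:UNIV - B|M. h x) = 0"
      if "B \<in> sigma_sets UNIV (Collect closed)" "(LINT x:B|M. h x) = 0" for B
    proof -
      have B: "B \<in> sets M" "UNIV - B \<in> sets M" using that sigma_M space_M sets.compl_sets[of B M] by auto
      have "(LINT x:B \<union> (UNIV - B)|M. h x) = (LINT x:B|M. h x) + (LINT x:UNIV - B|M. h x)"
        using B by (intro set_integral_Un set_int) auto
      then show ?thesis using that closed[of UNIV] by simp
    qed
    show "(LINT x:(\<Union>i. B i)|M. h x) = 0" if "disjoint_family B"
      "range B \<subseteq> sigma_sets UNIV (Collect closed)" "\<And>i. (LINT x:B i|M. h x) = 0" for B :: "nat \<Rightarrow> 'a set"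
    proof -
      have B: "B i \<in> sets M" for i using that sigma_M by auto
      have "(LINT x:(\<Union>i. B i)|M. h x) = (\<Sum>i. (LINT x:B i|M. h x))"
        using B that(1) by (intro lebesgue_integral_countable_add set_int)
          (auto simp: disjoint_family_on_def)
      then show ?thesis using that(3) by simp
    qed
    show "(LINT x:B|M. h x) = 0" if "B \<in> Collect closed" for B
      using closed that by simp
  qed (auto simp: set_lebesgue_integral_def)
qed

section \<open>Identification with the Laplacian\<close>

lemma form_commute: "form M \<delta> f g = form M \<delta> g f"
  by (simp add: form_def mult.commute)

lemma square_integrable_mult_bounded:
  assumes f: "f \<in> square_integrable M" and [measurable]: "g \<in> borel_measurable M" and bdd: "bounded (range g)"
  shows "integrable M (\<lambda>x. f x * g x)"
proof -
  have [measurable]: "f \<in> borel_measurable M" using f by (simp add: square_integrable_def)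
  obtain B where B: "\<And>x. \<bar>g x\<bar> \<le> B" using bdd by (auto simp: bounded_iff)
  have bound: "\<bar>f x * g x\<bar> \<le> \<bar>B * f x\<bar>" for x
  proof -
    have "\<bar>g x\<bar> \<le> \<bar>B\<bar>" using B[of x] by linarith
    then have "\<bar>g x\<bar> * \<bar>f x\<bar> \<le> \<bar>B\<bar> * \<bar>f x\<bar>" by (rule mult_right_mono) simp
    then show ?thesis by (metis abs_mult mult.commute)
  qed
  show ?thesis
  proof (rule Bochner_Integration.integrable_bound)
    show "integrable M (\<lambda>x. B * f x)" using integrable_of_square_integrable[OF f] by simp
    show "AE x in M. norm (f x * g x) \<le> norm (B * f x)"
      unfolding real_norm_def by (intro AE_I2 bound)
  qed measurable
qed

lemma holder_below_square_integrable:
  assumes "f \<in> holder_below \<alpha>"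
  shows "f \<in> square_integrable M"
proof (rule bounded_in_square_integrable)
  show "f \<in> borel_measurable M" unfolding borel_measurable_iff_borel
    using assms by (intro borel_measurable_continuous_onI uniformly_continuous_imp_continuous)
      (simp add: holder_below_def)
qed (use assms in \<open>simp add: holder_below_def\<close>)

lemma square_integrable_add:
  assumes f: "f \<in> square_integrable M" and g: "g \<in> square_integrable M" and bdd: "bounded (range g)"
  shows "(\<lambda>x. f x + g x) \<in> square_integrable M"
proof -
  have "integrable M (\<lambda>x. (f x)\<^sup>2 + 2 * (f x * g x) + (g x)\<^sup>2)"
    using f g square_integrable_mult_bounded[OF f _ bdd]
    by (intro Bochner_Integration.integrable_add integrable_mult_right) (auto simp: square_integrable_def)
  moreover have "(f x + g x)\<^sup>2 = (f x)\<^sup>2 + 2 * (f x * g x) + (g x)\<^sup>2" for x by (simp add: power2_sum)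
  moreover have "(\<lambda>x. f x + g x) \<in> borel_measurable M"
    using f g by (intro borel_measurable_add) (auto simp: square_integrable_def)
  ultimately show ?thesis by (simp add: square_integrable_def)
qed

lemma holder_below_form:
  assumes "0 < \<alpha>" "f \<in> holder_below \<alpha>"
  shows "f \<in> form_dom M \<delta>"
    and "g \<in> square_integrable M \<Longrightarrow> form M \<delta> f g = (LINT x|M. pointwise_laplacian M \<delta> f x * g x)"
proof -
  have half: "0 < \<alpha> / 2" "\<alpha> / 2 < \<alpha>" using assms(1) by auto
  then obtain C where C: "\<And>x y. \<bar>f x - f y\<bar> \<le> C * dist x y powr (\<alpha> / 2)"
    using assms(2) unfolding holder_below_def by blast
  show "f \<in> form_dom M \<delta>"
    using assms(2) by (intro bounded_holder_in_form_dom[OF half(1) C]) (simp add: holder_below_def)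
  show "form M \<delta> f g = (LINT x|M. pointwise_laplacian M \<delta> f x * g x)" if "g \<in> square_integrable M"
    using form_eq_pointwise_laplacian[OF half(1) C that] .
qed

lemma L2_class_eq_iff:
  assumes "f \<in> square_integrable M" "g \<in> square_integrable M"
  shows "L2_class M f = L2_class M g \<longleftrightarrow> (AE x in M. f x = g x)"
proof
  assume "L2_class M f = L2_class M g"
  then have "f \<in> L2_class M g" using assms by (auto simp: L2_class_def)
  then show "AE x in M. f x = g x" by (simp add: L2_class_def)
next
  assume ae: "AE x in M. f x = g x"
  have "(AE x in M. k x = f x) \<longleftrightarrow> (AE x in M. k x = g x)" for k
    using ae by (intro iffI; elim AE_mp) auto
  then show "L2_class M f = L2_class M g" by (simp add: L2_class_def)
qed

lemma laplacian_holder_below: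
  assumes \<alpha>: "0 < \<alpha>" "\<alpha> \<le> 1" and f: "f \<in> holder_below \<alpha>"
  shows "(L2_class M f, L2_class M (pointwise_laplacian M \<delta> f)) \<in> laplacian M \<delta>"
proof -
  let ?L = "pointwise_laplacian M \<delta> f"
  have L: "?L \<in> holder_below \<alpha>" by (rule pointwise_laplacian_in_holder_below[OF assms])
  have sq: "f \<in> square_integrable M" "?L \<in> square_integrable M"
    using f L by (auto intro: holder_below_square_integrable)
  have bdd: "bounded (range f)" "bounded (range ?L)" using f L by (auto simp: holder_below_def)
  define h where "h = (\<lambda>x. f x + ?L x)"
  have h: "h \<in> square_integrable M" unfolding h_def by (rule square_integrable_add[OF sq bdd(2)])
  have "(LINT x|M. f x * g x) + form M \<delta> f g = (LINT x|M. h x * g x)" if "g \<in> form_dom M \<delta>" for g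
  proof -
    have g: "g \<in> square_integrable M" using that by (simp add: form_dom_def)
    have "integrable M (\<lambda>x. f x * g x)" "integrable M (\<lambda>x. ?L x * g x)"
      using square_integrable_mult_bounded[OF g _ bdd(1)] square_integrable_mult_bounded[OF g _ bdd(2)] sq
      by (simp_all add: square_integrable_def mult.commute)
    then show ?thesis using holder_below_form(2)[OF \<alpha>(1) f g] by (simp add: h_def distrib_right)
  qed
  then have "(L2_class M h, L2_class M f) \<in> resolvent M \<delta>"
    unfolding resolvent_def using h holder_below_form(1)[OF \<alpha>(1) f] by blast
  then have "(L2_class M f, L2_class M (\<lambda>x. h x - f x)) \<in> laplacian M \<delta>"
    unfolding laplacian_def using h sq by blast
  then show ?thesis by (simp add: h_def)
qed

text \<open>
  If \<open>v\<close> represents \<open>f\<close> and solves the resolvent equation with right-hand side \<open>k\<close>, then testing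
  against a bounded Lipschitz \<open>g\<close> determines \<open>k\<close>.  By symmetry of the form, the singular integral can
  be moved to \<open>g\<close>; this replaces \<open>v\<close> by \<open>f\<close> inside a single integral, where almost everywhere equality
  is enough, and can then be undone.
\<close>

lemma laplacian_holder_below_unique:
  assumes \<alpha>: "0 < \<alpha>" "\<alpha> \<le> 1" and f: "f \<in> holder_below \<alpha>"
    and c: "(L2_class M f, c) \<in> laplacian M \<delta>"
  shows "c = L2_class M (pointwise_laplacian M \<delta> f)"
proof -
  let ?L = "pointwise_laplacian M \<delta> f"
  have L: "?L \<in> holder_below \<alpha>" by (rule pointwise_laplacian_in_holder_below[OF \<alpha> f])
  have sq: "f \<in> square_integrable M" "?L \<in> square_integrable M"
    using f L by (auto intro: holder_below_square_integrable)
  obtain h u where hu: "L2_class M f = L2_class M u" "c = L2_class M (\<lambda>x. h x - u x)"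
    "h \<in> square_integrable M" "u \<in> square_integrable M" "(L2_class M h, L2_class M u) \<in> resolvent M \<delta>"
    using c unfolding laplacian_def by blast
  then obtain k v where kv: "L2_class M h = L2_class M k" "L2_class M u = L2_class M v"
    "k \<in> square_integrable M" "v \<in> form_dom M \<delta>"
    "\<And>g. g \<in> form_dom M \<delta> \<Longrightarrow> (LINT x|M. v x * g x) + form M \<delta> v g = (LINT x|M. k x * g x)"
    unfolding resolvent_def by blast
  have v: "v \<in> square_integrable M" using kv(4) by (simp add: form_dom_def)
  have ae: "AE x in M. u x = f x" "AE x in M. v x = f x" "AE x in M. h x = k x"
    using hu kv v sq L2_class_eq_iff by metis+
  note ints = integrable_of_square_integrable
  have meas: "f \<in> borel_measurable M" "?L \<in> borel_measurable M" "v \<in> borel_measurable M" "k \<in> borel_measurable M"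
    "h \<in> borel_measurable M" "u \<in> borel_measurable M"
    using sq v kv hu by (auto simp: square_integrable_def)
  note meas [measurable]
  have "AE x in M. k x - f x - ?L x = 0"
  proof (rule AE_zero_of_Lipschitz_tests)
    show "integrable M (\<lambda>x. k x - f x - ?L x)" using kv sq by (intro Bochner_Integration.integrable_diff ints)
    fix g :: "'a \<Rightarrow> real" and C
    assume Lip: "\<And>x y. \<bar>g x - g y\<bar> \<le> C * dist x y" and bdd: "bounded (range g)"
    then have hol: "\<And>x y. \<bar>g x - g y\<bar> \<le> C * dist x y powr 1" by simp
    have gM [measurable]: "g \<in> borel_measurable M" by (rule borel_measurable_of_holder[OF zero_less_one hol])
    have g: "g \<in> form_dom M \<delta>" "g \<in> square_integrable M"
      using bounded_holder_in_form_dom[OF zero_less_one hol bdd] by (auto simp: form_dom_def)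
    have [measurable]: "pointwise_laplacian M \<delta> g \<in> borel_measurable M"
      unfolding pointwise_laplacian_def by measurable
    have "form M \<delta> v g = (LINT x|M. pointwise_laplacian M \<delta> g x * v x)"
      unfolding form_commute[of v] by (rule form_eq_pointwise_laplacian[OF zero_less_one hol v])
    also have "\<dots> = (LINT x|M. pointwise_laplacian M \<delta> g x * f x)"
      by (rule integral_cong_AE) (use ae(2) in auto)
    also have "\<dots> = form M \<delta> f g"
      unfolding form_commute[of f] by (rule form_eq_pointwise_laplacian[OF zero_less_one hol sq(1), symmetric])
    also have "\<dots> = (LINT x|M. ?L x * g x)" by (rule holder_below_form(2)[OF \<alpha>(1) f g(2)])
    finally have "form M \<delta> v g = (LINT x|M. ?L x * g x)" .
    moreover have "(LINT x|M. v x * g x) = (LINT x|M. f x * g x)"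
      by (rule integral_cong_AE) (use ae(2) in auto)
    ultimately have "(LINT x|M. f x * g x) + (LINT x|M. ?L x * g x) = (LINT x|M. k x * g x)"
      using kv(5)[OF g(1)] by simp
    then show "(LINT x|M. (k x - f x - ?L x) * g x) = 0"
      using square_integrable_mult_bounded[OF _ gM bdd] kv(3) sq by (simp add: left_diff_distrib)
  qed
  then have final: "AE x in M. h x - u x = ?L x" using ae(1,3) by eventually_elim simp
  have "AE x in M. (h x - u x)\<^sup>2 = (?L x)\<^sup>2" using final by eventually_elim simp
  then have "integrable M (\<lambda>x. (h x - u x)\<^sup>2) \<longleftrightarrow> integrable M (\<lambda>x. (?L x)\<^sup>2)"
    by (intro integrable_cong_AE) auto
  then have "(\<lambda>x. h x - u x) \<in> square_integrable M"
    using sq(2) by (simp add: square_integrable_def)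
  then show ?thesis unfolding hu(2) using final sq(2) by (simp add: L2_class_eq_iff)
qed

end

theorem proposition4p12:
  fixes M :: "'a::{metric_space, second_countable_topology} measure"
    and \<delta> \<alpha> :: real
  assumes "ahlfors_regular M \<delta>"
    and "0 < \<alpha>" and "\<alpha> \<le> 1"
  shows "laplacian M \<delta> `` (L2_class M ` holder_below \<alpha>) \<subseteq> L2_class M ` holder_below \<alpha> \<and>
         L2_class M ` holder_below \<alpha> \<subseteq> smooth_vectors (laplacian M \<delta>)"
proof -
  interpret ahlfors_regular M \<delta> by fact
  let ?L = "pointwise_laplacian M \<delta>"
  have "laplacian M \<delta> `` (L2_class M ` holder_below \<alpha>) \<subseteq> L2_class M ` holder_below \<alpha>"
    using laplacian_holder_below_unique[OF assms(2,3)] pointwise_laplacian_in_holder_below[OF assms(2,3)]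
    by blast
  moreover have "L2_class M f \<in> Domain (laplacian M \<delta> ^^ n)" if "f \<in> holder_below \<alpha>" for n f
    using that
  proof (induction n arbitrary: f)
    case (Suc n)
    have "L2_class M (?L f) \<in> Domain (laplacian M \<delta> ^^ n)"
      by (rule Suc.IH[OF pointwise_laplacian_in_holder_below[OF assms(2,3) Suc.prems]])
    then show ?case
      using laplacian_holder_below[OF assms(2,3) Suc.prems] by (blast intro: relpow_Suc_I2)
  qed auto
  ultimately show ?thesis by (auto simp: smooth_vectors_def)
qed

end
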